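(* Let $d\ge1$ and let $f$ be a uniformly continuous probability density on $\mathbb{R}^d$. Then for every integer $k\ge1$, $\mathrm{H}_r^kf_r(x)\to f(x)$ as $r\to0^+$, uniformly in $x\in\mathbb{R}^d$.
   Context: $\mathsf{B}(x,r)$ is the closed Euclidean ball of center $x$ and radius $r$, and $\omega$ is the volume of the unit ball of $\mathbb{R}^d$. For $r>0$ and a non-negative bounded measurable $\phi:\mathbb{R}^d\to\mathbb{R}$, $$\mathrm{H}_r\phi(x)=\sup\Big\{t\ge0 : \frac1{\omega r^d}\int_{\mathsf{B}(x,r)}\mathbf{1}_{\phi(z)\ge t}\,f(z)\,dz\ge t\Big\},$$ $\mathrm{H}_r^k$ is its $k$-th iterate, and $f_r(x)=\frac{1}{\omega r^d}\int_{\mathsf{B}(x,r)}f(z)\,dz$. *)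

theory Defs
  imports "HOL-Analysis.Analysis"
begin

text \<open>
  The space \<open>\<real>\<^sup>d\<close> with \<open>d \<ge> 1\<close> is an arbitrary type \<open>'a :: euclidean_space\<close>, with \<open>d = DIM('a)\<close>;
  \<open>\<omega>\<close> is \<open>measure lborel (cball (0::'a) 1)\<close>.
\<close>

definition ball_average :: "('a::euclidean_space \<Rightarrow> real) \<Rightarrow> real \<Rightarrow> 'a \<Rightarrow> real" where
  "ball_average f r x =
     1 / (measure lborel (cball (0::'a) 1) * r ^ DIM('a)) * (LINT z:cball x r|lborel. f z)"

text \<open>
  For \<open>r > 0\<close>, a density \<open>f\<close> and a non-negative, bounded, Borel measurable \<open>\<phi>\<close>, the set
  below contains \<open>0\<close> and is bounded above by \<open>ball_average f r x\<close>, so that \<open>Sup\<close> is a genuine supremum.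
  The definition is total in \<open>\<phi>\<close>, so that \<open>H_op f r\<close> can be iterated with \<open>^^\<close>.
\<close>

definition H_op ::
    "('a::euclidean_space \<Rightarrow> real) \<Rightarrow> real \<Rightarrow> ('a \<Rightarrow> real) \<Rightarrow> 'a \<Rightarrow> real" where
  "H_op f r \<phi> x =
     Sup {t. t \<ge> 0 \<and>
       1 / (measure lborel (cball (0::'a) 1) * r ^ DIM('a)) *
         (LINT z:cball x r|lborel. indicator {z. \<phi> z \<ge> t} z * f z) \<ge> t}"

end

theory Submission
  imports Defs
begin

text \<open>
  Fix \<open>\<epsilon> > 0\<close> and let \<open>r\<close> be so small that, by uniform continuity, \<open>f\<close> differs by at most \<open>\<epsilon>\<close> from
  its value at the center on every ball of radius \<open>r\<close>.  Then averaging
  over a ball moves \<open>f\<close> by at most \<open>\<epsilon>\<close>, and \<^term>\<open>H_op f r\<close> increases the uniform distance to \<open>f\<close> by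
  at most \<open>\<epsilon>\<close> (\<open>H_op_close\<close>).  After \<open>k\<close> iterations the distance to \<open>f\<close> is at most
  \<open>(k + 1) * \<epsilon>\<close>, uniformly in the point.

  The second ingredient is measurability.  The average that defines \<^term>\<open>H_op f r \<phi>\<close> is an
  integral of \<open>f\<close> over a superlevel set of \<open>\<phi>\<close>, which is meaningful only if \<open>\<phi>\<close> is measurable; so
  the iteration has to carry along that \<^term>\<open>H_op f r\<close> preserves measurability
  (\<open>borel_measurable_H_op\<close>).
\<close>

section \<open>Averages over balls\<close>

lemma measure_lborel_cball:
  fixes x :: "'a::euclidean_space"
  assumes "r \<ge> 0"
  shows "measure lborel (cball x r) = measure lborel (cball (0::'a) 1) * r ^ DIM('a)"
  using assms content_cball[of r x] content_cball[of 1 "0::'a"] by simp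

lemma ball_average_const:
  fixes x :: "'a::euclidean_space"
  assumes "r > 0"
  shows "ball_average (\<lambda>_. c) r x = c"
proof -
  have "measure lborel (cball x r) > 0"
    using assms content_cball_pos by blast
  moreover have "(LINT z:cball x r|lborel. c) = c * measure lborel (cball x r)"
    using emeasure_bounded_finite[of "cball x r"] by (simp add: set_lebesgue_integral_def)
  ultimately show ?thesis
    unfolding ball_average_def using measure_lborel_cball[of r x] assms by simp
qed

lemma ball_average_mono:
  fixes x :: "'a::euclidean_space"
  assumes "r \<ge> 0"
    and "set_integrable lborel (cball x r) g" "set_integrable lborel (cball x r) h"
    and "\<And>z. z \<in> cball x r \<Longrightarrow> g z \<le> h z"
  shows "ball_average g r x \<le> ball_average h r x"
  unfolding ball_average_def
  using assms by (intro mult_left_mono set_integral_mono) auto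

lemma ball_average_cong:
  assumes "\<And>z. z \<in> cball x r \<Longrightarrow> g z = h z"
  shows "ball_average g r x = ball_average h r x"
proof -
  have "(LINT z:cball x r|lborel. g z) = (LINT z:cball x r|lborel. h z)"
    using assms by (intro set_lebesgue_integral_cong) auto
  then show ?thesis by (simp add: ball_average_def)
qed

lemma set_integrable_cball_const:
  "set_integrable lborel (cball (x::'a::euclidean_space) r) (\<lambda>_. c::real)"
  unfolding set_integrable_def using emeasure_bounded_finite[of "cball x r"] by simp

lemma integrable_imp_set_integrable_cball:
  fixes f :: "'a::euclidean_space \<Rightarrow> real"
  assumes "integrable lborel f"
  shows "set_integrable lborel (cball x r) f"
  using integrable_mult_indicator[of "cball x r" lborel f] assms by (simp add: set_integrable_def)

lemma ball_average_close:
  fixes x :: "'a::euclidean_space"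
  assumes "r > 0" and "set_integrable lborel (cball x r) g"
    and "\<And>z. z \<in> cball x r \<Longrightarrow> \<bar>g z - c\<bar> \<le> e"
  shows "\<bar>ball_average g r x - c\<bar> \<le> e"
proof -
  have "ball_average (\<lambda>_. c - e) r x \<le> ball_average g r x"
    using assms by (intro ball_average_mono set_integrable_cball_const) (auto simp: abs_le_iff; force)+
  moreover have "ball_average g r x \<le> ball_average (\<lambda>_. c + e) r x"
    using assms by (intro ball_average_mono set_integrable_cball_const) (auto simp: abs_le_iff; force)+
  ultimately show ?thesis
    using assms by (simp add: ball_average_const)
qed

text \<open>
  The average is a parametric integral of the jointly measurable function
  \<open>(x, z) \<mapsto> indicator (cball x r) z * g z\<close>, whose indicator is that of a closed set of pairs.
\<close>

lemma borel_measurable_ball_average: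
  fixes g :: "'a::euclidean_space \<Rightarrow> real"
  assumes [measurable]: "g \<in> borel_measurable borel"
  shows "ball_average g r \<in> borel_measurable borel"
proof -
  have "closed {p :: 'a \<times> 'a. dist (fst p) (snd p) \<le> r}"
    by (intro closed_Collect_le continuous_intros)
  then have [measurable]: "{p :: 'a \<times> 'a. dist (fst p) (snd p) \<le> r} \<in> sets (borel \<Otimes>\<^sub>M borel)"
    unfolding borel_prod by (rule borel_closed)
  have "(\<lambda>(x, z). indicator {p. dist (fst p) (snd p) \<le> r} (x, z) * g z)
          \<in> borel_measurable (borel \<Otimes>\<^sub>M lborel)"
    by measurable
  then have "(\<lambda>x. LINT z|lborel. indicator {p. dist (fst p) (snd p) \<le> r} (x, z) * g z)
          \<in> borel_measurable borel"
    by (rule lborel.borel_measurable_lebesgue_integral)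
  moreover have "(\<lambda>x. LINT z|lborel. indicator {p. dist (fst p) (snd p) \<le> r} (x, z) * g z)
      = (\<lambda>x. LINT z:cball x r|lborel. g z)"
    unfolding set_lebesgue_integral_def by (intro ext Bochner_Integration.integral_cong)
      (auto simp: indicator_def)
  ultimately have [measurable]: "(\<lambda>x. LINT z:cball x r|lborel. g z) \<in> borel_measurable borel"
    by simp
  show ?thesis
    unfolding ball_average_def[abs_def] by measurable
qed

section \<open>The operator\<close>

lemma superlevel_integrable:
  fixes f \<phi> :: "'a::euclidean_space \<Rightarrow> real"
  assumes "integrable lborel f" and [measurable]: "\<phi> \<in> borel_measurable borel"
  shows "set_integrable lborel (cball x r) (\<lambda>z. indicator {z. \<phi> z \<ge> t} z * f z)"
proof -
  have "integrable lborel (\<lambda>z. indicator {z. \<phi> z \<ge> t} z * f z)"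
    using integrable_mult_indicator[OF _ assms(1), of "{z. \<phi> z \<ge> t}"] by simp
  then show ?thesis
    by (rule integrable_imp_set_integrable_cball)
qed

definition H_levels :: "('a::euclidean_space \<Rightarrow> real) \<Rightarrow> real \<Rightarrow> ('a \<Rightarrow> real) \<Rightarrow> 'a \<Rightarrow> real set" where
  "H_levels f r \<phi> x =
     {t. t \<ge> 0 \<and> ball_average (\<lambda>z. indicator {z. \<phi> z \<ge> t} z * f z) r x \<ge> t}"

lemma H_op_eq_Sup_H_levels: "H_op f r \<phi> x = Sup (H_levels f r \<phi> x)"
  by (simp add: H_op_def H_levels_def ball_average_def)

context
  fixes f :: "'a::euclidean_space \<Rightarrow> real" and r :: real
  assumes nonneg: "\<And>x. f x \<ge> 0" and integrable: "integrable lborel f" and r: "r > 0"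
begin

lemma zero_in_H_levels: "0 \<in> H_levels f r \<phi> x"
  using nonneg r by (auto simp: H_levels_def ball_average_def set_lebesgue_integral_def
      intro!: divide_nonneg_nonneg mult_nonneg_nonneg Bochner_Integration.integral_nonneg)

lemma H_levels_le_ball_average:
  assumes "\<phi> \<in> borel_measurable borel" and "t \<in> H_levels f r \<phi> x"
  shows "t \<le> ball_average f r x"
proof -
  have "ball_average (\<lambda>z. indicator {z. \<phi> z \<ge> t} z * f z) r x \<le> ball_average f r x"
    using r nonneg
    by (intro ball_average_mono superlevel_integrable integrable assms
        integrable_imp_set_integrable_cball) (auto simp: indicator_def)
  then show ?thesis
    using assms by (simp add: H_levels_def)
qed

lemma bdd_above_H_levels:
  assumes "\<phi> \<in> borel_measurable borel"
  shows "bdd_above (H_levels f r \<phi> x)"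
  using H_levels_le_ball_average[OF assms] by (rule bdd_aboveI)

text \<open>
  Lowering the level enlarges the superlevel set and relaxes the bound, so the admissible levels form
  an interval; this is what makes rational levels sufficient below.
\<close>

lemma H_levels_downward_closed:
  assumes "\<phi> \<in> borel_measurable borel" and "t \<in> H_levels f r \<phi> x" and "0 \<le> s" "s \<le> t"
  shows "s \<in> H_levels f r \<phi> x"
proof -
  have "ball_average (\<lambda>z. indicator {z. \<phi> z \<ge> t} z * f z) r x
      \<le> ball_average (\<lambda>z. indicator {z. \<phi> z \<ge> s} z * f z) r x"
    using r nonneg assms(4)
    by (intro ball_average_mono superlevel_integrable integrable assms)
      (auto simp: indicator_def)
  then show ?thesis
    using assms by (simp add: H_levels_def)
qed

lemma less_H_op_iff:
  assumes "\<phi> \<in> borel_measurable borel"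
  shows "s < H_op f r \<phi> x \<longleftrightarrow> (\<exists>q\<in>\<rat>. s < q \<and> q \<in> H_levels f r \<phi> x)"
proof
  assume "s < H_op f r \<phi> x"
  then obtain t where t: "s < t" "t \<in> H_levels f r \<phi> x"
    using less_cSup_iff[of "H_levels f r \<phi> x" s] zero_in_H_levels bdd_above_H_levels[OF assms]
    by (auto simp: H_op_eq_Sup_H_levels)
  show "\<exists>q\<in>\<rat>. s < q \<and> q \<in> H_levels f r \<phi> x"
  proof (cases "s < 0")
    case True
    then show ?thesis using zero_in_H_levels by (intro bexI[of _ 0]) auto
  next
    case False
    obtain q where "q \<in> \<rat>" "s < q" "q < t"
      using Rats_dense_in_real[OF t(1)] by blast
    then show ?thesis
      using H_levels_downward_closed[OF assms t(2), of q] False by auto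
  qed
next
  assume "\<exists>q\<in>\<rat>. s < q \<and> q \<in> H_levels f r \<phi> x"
  then show "s < H_op f r \<phi> x"
    using cSup_upper[OF _ bdd_above_H_levels[OF assms]]
    by (force simp: H_op_eq_Sup_H_levels intro: less_le_trans)
qed

text \<open>
  Each superlevel set of \<^term>\<open>H_op f r \<phi>\<close> is a countable union, over rational levels, of superlevel
  sets of ball averages.
\<close>

lemma borel_measurable_H_op:
  assumes [measurable]: "\<phi> \<in> borel_measurable borel"
  shows "H_op f r \<phi> \<in> borel_measurable borel"
proof (rule borel_measurableI_greater)
  fix s
  let ?A = "\<lambda>q. ball_average (\<lambda>z. indicator {z. \<phi> z \<ge> q} z * f z) r"
  have [measurable]: "f \<in> borel_measurable borel"
    using integrable by auto
  have "(\<lambda>z. indicator {z. \<phi> z \<ge> q} z * f z) \<in> borel_measurable borel" for q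
    by measurable
  then have [measurable]: "?A q \<in> borel_measurable borel" for q
    by (rule borel_measurable_ball_average)
  have "{x. s < H_op f r \<phi> x} = (\<Union>q \<in> {q\<in>\<rat>. s < q \<and> q \<ge> 0}. {x. q \<le> ?A q x})"
    by (auto simp: less_H_op_iff H_levels_def)
  also have "\<dots> \<in> sets borel"
    by (intro sets.countable_UN' countable_subset[OF _ countable_rat]) auto
  finally show "{x \<in> space borel. s < H_op f r \<phi> x} \<in> sets borel"
    by simp
qed

text \<open>
  Admissible levels never exceed the plain average of \<open>f\<close>, hence the upper bound.  For the lower bound
  take \<open>t = f x - (c + e)\<close>: all of the ball lies in the superlevel set of \<open>\<phi>\<close> at height \<open>t\<close>, so the
  restricted average is the full one, which is at least \<open>f x - e\<close>.  If \<open>t\<close> is negative, the level \<open>0\<close> suffices.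
\<close>

lemma H_op_close:
  assumes "\<phi> \<in> borel_measurable borel" and close: "\<And>z. \<bar>\<phi> z - f z\<bar> \<le> c"
    and osc: "\<And>z. z \<in> cball x r \<Longrightarrow> \<bar>f z - f x\<bar> \<le> e"
  shows "\<bar>H_op f r \<phi> x - f x\<bar> \<le> c + e"
proof -
  have "c \<ge> 0" using close[of x] by linarith
  have avg: "\<bar>ball_average f r x - f x\<bar> \<le> e"
    using r osc by (intro ball_average_close integrable_imp_set_integrable_cball integrable)
  have "H_op f r \<phi> x \<le> ball_average f r x"
    unfolding H_op_eq_Sup_H_levels
    by (rule cSup_least) (use zero_in_H_levels H_levels_le_ball_average[OF assms(1)] in blast)+
  moreover have "f x - (c + e) \<le> H_op f r \<phi> x"
  proof (cases "f x - (c + e) \<ge> 0")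
    case True
    have "f x - (c + e) \<le> \<phi> z" if "z \<in> cball x r" for z
      using close[of z] osc[OF that] by linarith
    then have "ball_average (\<lambda>z. indicator {z. \<phi> z \<ge> f x - (c + e)} z * f z) r x
        = ball_average f r x"
      by (intro ball_average_cong) (simp add: indicator_def)
    then have "f x - (c + e) \<in> H_levels f r \<phi> x"
      using True avg \<open>c \<ge> 0\<close> by (simp add: H_levels_def)
    then show ?thesis
      unfolding H_op_eq_Sup_H_levels by (intro cSup_upper bdd_above_H_levels assms(1))
  next
    case False
    have "0 \<le> H_op f r \<phi> x"
      unfolding H_op_eq_Sup_H_levels
      by (intro cSup_upper zero_in_H_levels bdd_above_H_levels assms(1))
    with False show ?thesis by linarith
  qed
  ultimately show ?thesis
    using avg \<open>c \<ge> 0\<close> by linarith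
qed

lemma H_op_iterate_close:
  assumes osc: "\<And>x z. z \<in> cball x r \<Longrightarrow> \<bar>f z - f x\<bar> \<le> e"
  shows "(H_op f r ^^ k) (ball_average f r) \<in> borel_measurable borel \<and>
    (\<forall>x. \<bar>(H_op f r ^^ k) (ball_average f r) x - f x\<bar> \<le> (real k + 1) * e)"
proof (induction k)
  case 0
  have "f \<in> borel_measurable borel"
    using integrable by auto
  then show ?case
    using r osc by (auto intro!: borel_measurable_ball_average ball_average_close
        integrable_imp_set_integrable_cball integrable)
next
  case (Suc k)
  let ?\<phi> = "(H_op f r ^^ k) (ball_average f r)"
  have "\<bar>H_op f r ?\<phi> x - f x\<bar> \<le> (real k + 1) * e + e" for x
    using Suc osc by (intro H_op_close) auto
  then show ?case
    using Suc borel_measurable_H_op by (simp add: algebra_simps)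
qed

end

section \<open>Uniform convergence\<close>

theorem proposition2p5:
  fixes f :: "'a::euclidean_space \<Rightarrow> real" and k :: nat
  assumes "uniformly_continuous_on UNIV f"
    and "\<And>x. f x \<ge> 0"
    and "integrable lborel f"
    and "integral\<^sup>L lborel f = 1"
    and "k \<ge> 1"
  shows "uniform_limit UNIV (\<lambda>r. (H_op f r ^^ k) (ball_average f r)) f (at_right 0)"
proof (rule uniform_limitI)
  fix \<epsilon> :: real
  assume "\<epsilon> > 0"
  \<comment> \<open>One share of \<open>e\<close> for the initial average and one for each iteration, with one left over to make
    the final inequality strict.\<close>
  define e where "e = \<epsilon> / (real k + 2)"
  have "e > 0" using \<open>\<epsilon> > 0\<close> by (simp add: e_def)
  have less: "(real k + 1) * e < \<epsilon>"
    using \<open>\<epsilon> > 0\<close> by (simp add: e_def field_simps)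
  obtain d where "d > 0" and d: "\<And>x z. dist z x < d \<Longrightarrow> dist (f z) (f x) < e"
    using assms(1) \<open>e > 0\<close> unfolding uniformly_continuous_on_def by blast
  have "\<forall>\<^sub>F r in at_right 0. 0 < r \<and> r < d"
    using \<open>d > 0\<close> by (auto simp: eventually_at_right)
  then show "\<forall>\<^sub>F r in at_right 0. \<forall>x\<in>UNIV.
      dist ((H_op f r ^^ k) (ball_average f r) x) (f x) < \<epsilon>"
  proof eventually_elim
    case (elim r)
    have "\<bar>f z - f x\<bar> \<le> e" if "z \<in> cball x r" for x z
      using d[of z x] that elim by (simp add: dist_commute dist_real_def)
    then show ?case
      using H_op_iterate_close[OF assms(2,3), of r e k] elim less
      by (auto simp: dist_real_def intro: le_less_trans)
  qed
qed

end
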